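(* Let $n\ge0$, and let $F_n$ and $R_n$ be the free group and the free rack on $n$ generators $y_1,\dots,y_n$, respectively. Then there is a group isomorphism $$G_{\mathrm{Rack}}(R_n)\cong\mathbb{Z}\times F_n,$$ where $G_{\mathrm{Rack}}(R_n)$ is the logical isotropy group of $R_n$.
   Context: A rack is a set with two binary operations $\lhd,\lhd^{-1}$ satisfying, for all $x,y,z$: $(x\lhd y)\lhd z=(x\lhd z)\lhd(y\lhd z)$; $(x\lhd^{-1}y)\lhd^{-1}z=(x\lhd^{-1}z)\lhd^{-1}(y\lhd^{-1}z)$; $(x\lhd y)\lhd^{-1}y=x$; $(x\lhd^{-1}y)\lhd y=x$. We write $\lhd^{1}=\lhd$. For a finite set $X$ of constants, $\Sigma(X)$ is the signature with binary symbols $\lhd,\lhd^{-1}$ and the elements of $X$ as constants. For closed terms $s,t$ over $\Sigma(X)$, $s\sim t$ means that $s=t$ is provable from the rack axioms over $\Sigma(X)$; $[t]$ is the $\sim$-class of $t$. The free rack on $y_1,\dots,y_n$ is the set $R_n$ of $\sim$-classes of closed terms over $\Sigma(y_1,\dots,y_n)$. Let $x,x_0,x_1$ be further distinct constants, and let $t[s/x]$ denote the result of replacing every occurrence of $x$ in $t$ by $s$. The logical isotropy group $G_{\mathrm{Rack}}(R_n)$ is the set of all classes $[t]$ of closed terms $t$ over $\Sigma(x,y_1,\dots,y_n)$ (modulo provable equality in the theory of racks) such that: (1) $[t]$ is invertible: there is a closed term $s$ over $\Sigma(x,y_1,\dots,y_n)$ with $t[s/x]\sim x\sim s[t/x]$;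 and (2) $[t]$ commutes generically with the operations: $t[(x_0\lhd^{\epsilon} x_1)/x]\sim t[x_0/x]\lhd^{\epsilon} t[x_1/x]$ over $\Sigma(x_0,x_1,y_1,\dots,y_n)$ for $\epsilon=1$ and $\epsilon=-1$. It is a group with unit $[x]$ and product $[t]\cdot[s]=[t[s/x]]$. *)

theory Defs
  imports "HOL-Algebra.Elementary_Groups"
begin

section \<open>Terms and provability in the equational theory of racks\<close>

datatype (term_consts: 'c, term_vars: 'v) rack_term =
    Var 'v
  | Const 'c
  | Op "('c, 'v) rack_term" "('c, 'v) rack_term"  (infixl \<open>\<lhd>\<^sub>r\<close> 70)
  | Op_inv "('c, 'v) rack_term" "('c, 'v) rack_term"  (infixl \<open>\<lhd>\<^sub>r\<^sup>-\<close> 70)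

primrec subst_vars :: "('v \<Rightarrow> ('c, 'w) rack_term) \<Rightarrow> ('c, 'v) rack_term \<Rightarrow> ('c, 'w) rack_term" where
  "subst_vars \<sigma> (Var v) = \<sigma> v"
| "subst_vars \<sigma> (Const c) = Const c"
| "subst_vars \<sigma> (s \<lhd>\<^sub>r t) = subst_vars \<sigma> s \<lhd>\<^sub>r subst_vars \<sigma> t"
| "subst_vars \<sigma> (s \<lhd>\<^sub>r\<^sup>- t) = subst_vars \<sigma> s \<lhd>\<^sub>r\<^sup>- subst_vars \<sigma> t"

text \<open>The term \<open>subst_const c s t\<close> is written t[s/c] on paper.\<close>

primrec subst_const :: "'c \<Rightarrow> ('c, 'v) rack_term \<Rightarrow> ('c, 'v) rack_term \<Rightarrow> ('c, 'v) rack_term" where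
  "subst_const c s (Var v) = Var v"
| "subst_const c s (Const d) = (if d = c then s else Const d)"
| "subst_const c s (t \<lhd>\<^sub>r u) = subst_const c s t \<lhd>\<^sub>r subst_const c s u"
| "subst_const c s (t \<lhd>\<^sub>r\<^sup>- u) = subst_const c s t \<lhd>\<^sub>r\<^sup>- subst_const c s u"

text \<open>Equational logic over the signature with the two binary symbols and the constants \<open>C\<close>.
  Every term occurring in a derivation uses only constants from \<open>C\<close>; variables are natural
  numbers.\<close>

inductive rack_provable :: "'c set \<Rightarrow> ('c, nat) rack_term \<Rightarrow> ('c, nat) rack_term \<Rightarrow> bool"
  for C :: "'c set" where
  distrib: "rack_provable C
     ((Var 0 \<lhd>\<^sub>r Var 1) \<lhd>\<^sub>r Var 2) ((Var 0 \<lhd>\<^sub>r Var 2) \<lhd>\<^sub>r (Var 1 \<lhd>\<^sub>r Var 2))"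
| distrib_inv: "rack_provable C
     ((Var 0 \<lhd>\<^sub>r\<^sup>- Var 1) \<lhd>\<^sub>r\<^sup>- Var 2) ((Var 0 \<lhd>\<^sub>r\<^sup>- Var 2) \<lhd>\<^sub>r\<^sup>- (Var 1 \<lhd>\<^sub>r\<^sup>- Var 2))"
| cancel: "rack_provable C ((Var 0 \<lhd>\<^sub>r Var 1) \<lhd>\<^sub>r\<^sup>- Var 1) (Var 0)"
| cancel_inv: "rack_provable C ((Var 0 \<lhd>\<^sub>r\<^sup>- Var 1) \<lhd>\<^sub>r Var 1) (Var 0)"
| refl: "term_consts t \<subseteq> C \<Longrightarrow> rack_provable C t t"
| sym: "rack_provable C s t \<Longrightarrow> rack_provable C t s"
| trans: "rack_provable C s t \<Longrightarrow> rack_provable C t u \<Longrightarrow> rack_provable C s u"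
| cong: "rack_provable C s s' \<Longrightarrow> rack_provable C t t' \<Longrightarrow>
     rack_provable C (s \<lhd>\<^sub>r t) (s' \<lhd>\<^sub>r t')"
| cong_inv: "rack_provable C s s' \<Longrightarrow> rack_provable C t t' \<Longrightarrow>
     rack_provable C (s \<lhd>\<^sub>r\<^sup>- t) (s' \<lhd>\<^sub>r\<^sup>- t')"
| instantiate: "rack_provable C s t \<Longrightarrow> (\<And>v. term_consts (\<sigma> v) \<subseteq> C) \<Longrightarrow>
     rack_provable C (subst_vars \<sigma> s) (subst_vars \<sigma> t)"

definition closed_terms :: "'c set \<Rightarrow> ('c, nat) rack_term set" where
  "closed_terms C = {t. term_consts t \<subseteq> C \<and> term_vars t = {}}"

definition rack_eq :: "'c set \<Rightarrow> (('c, nat) rack_term \<times> ('c, nat) rack_term) set" where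
  "rack_eq C = {(s, t). s \<in> closed_terms C \<and> t \<in> closed_terms C \<and> rack_provable C s t}"


section \<open>The logical isotropy group of the free rack on n generators\<close>

text \<open>The elements of the free rack are the classes of closed terms over its generators, so terms over
  the rack with an indeterminate \<open>Sx\<close> adjoined are closed terms over \<open>Sx\<close> and the generators.\<close>

datatype const_sym = Sx | Sx0 | Sx1 | Sy nat

definition gens :: "nat \<Rightarrow> const_sym set" where
  "gens n = Sy ` {1..n}"

definition isotropy_invertible :: "nat \<Rightarrow> (const_sym, nat) rack_term \<Rightarrow> bool" where
  "isotropy_invertible n t \<longleftrightarrow> (\<exists>s \<in> closed_terms (insert Sx (gens n)).
     (subst_const Sx s t, Const Sx) \<in> rack_eq (insert Sx (gens n)) \<and>
     (Const Sx, subst_const Sx t s) \<in> rack_eq (insert Sx (gens n)))"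

definition commutes_generically :: "nat \<Rightarrow> (const_sym, nat) rack_term \<Rightarrow> bool" where
  "commutes_generically n t \<longleftrightarrow>
     (subst_const Sx (Const Sx0 \<lhd>\<^sub>r Const Sx1) t,
      subst_const Sx (Const Sx0) t \<lhd>\<^sub>r subst_const Sx (Const Sx1) t)
        \<in> rack_eq ({Sx0, Sx1} \<union> gens n) \<and>
     (subst_const Sx (Const Sx0 \<lhd>\<^sub>r\<^sup>- Const Sx1) t,
      subst_const Sx (Const Sx0) t \<lhd>\<^sub>r\<^sup>- subst_const Sx (Const Sx1) t)
        \<in> rack_eq ({Sx0, Sx1} \<union> gens n)"

text \<open>The product of classes is the union of the classes of the products of all
  representatives; as substitution respects provable equality, these classes all coincide.\<close>

definition isotropy_free_rack :: "nat \<Rightarrow> (const_sym, nat) rack_term set monoid" where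
  "isotropy_free_rack n =
    \<lparr>carrier = {rack_eq (insert Sx (gens n)) `` {t} | t.
       t \<in> closed_terms (insert Sx (gens n)) \<and> isotropy_invertible n t \<and> commutes_generically n t},
     monoid.mult = (\<lambda>A B. \<Union>t\<in>A. \<Union>s\<in>B. rack_eq (insert Sx (gens n)) `` {subst_const Sx s t}),
     one = rack_eq (insert Sx (gens n)) `` {Const Sx}\<rparr>"


section \<open>The free group on a set\<close>

text \<open>A letter \<open>(True, a)\<close> stands for the generator \<open>a\<close>, and \<open>(False, a)\<close> for its formal inverse.\<close>

definition words :: "'a set \<Rightarrow> (bool \<times> 'a) list set" where
  "words S = lists (UNIV \<times> S)"

inductive free_equiv :: "(bool \<times> 'a) list \<Rightarrow> (bool \<times> 'a) list \<Rightarrow> bool" where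
  cancel: "free_equiv (u @ [(b, a), (\<not> b, a)] @ v) (u @ v)"
| refl: "free_equiv u u"
| sym: "free_equiv u v \<Longrightarrow> free_equiv v u"
| trans: "free_equiv u v \<Longrightarrow> free_equiv v w \<Longrightarrow> free_equiv u w"

definition free_rel :: "'a set \<Rightarrow> ((bool \<times> 'a) list \<times> (bool \<times> 'a) list) set" where
  "free_rel S = {(u, v). u \<in> words S \<and> v \<in> words S \<and> free_equiv u v}"

definition free_group :: "'a set \<Rightarrow> (bool \<times> 'a) list set monoid" where
  "free_group S =
    \<lparr>carrier = words S // free_rel S,
     monoid.mult = (\<lambda>A B. \<Union>u\<in>A. \<Union>v\<in>B. free_rel S `` {u @ v}),
     one = free_rel S `` {[]}\<rparr>"

lemma equiv_free_rel: "equiv (words S) (free_rel S)"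
  by (rule equivI)
    (auto simp: free_rel_def refl_on_def sym_def trans_def intro: free_equiv.intros)

lemma free_equiv_append_left: "free_equiv u v \<Longrightarrow> free_equiv (w @ u) (w @ v)"
proof (induction rule: free_equiv.induct)
  case (cancel u b a v)
  then show ?case using free_equiv.cancel[of "w @ u" b a v] by simp
qed (auto intro: free_equiv.intros)

lemma free_equiv_append_right: "free_equiv u v \<Longrightarrow> free_equiv (u @ w) (v @ w)"
proof (induction rule: free_equiv.induct)
  case (cancel u b a v)
  then show ?case using free_equiv.cancel[of u b a "v @ w"] by simp
qed (auto intro: free_equiv.intros)

lemma words_append [simp]: "u @ v \<in> words S \<longleftrightarrow> u \<in> words S \<and> v \<in> words S"
  by (auto simp: words_def)

lemma free_group_mult:
  assumes "u \<in> words S" "v \<in> words S"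
  shows "free_rel S `` {u} \<otimes>\<^bsub>free_group S\<^esub> free_rel S `` {v} = free_rel S `` {u @ v}"
proof -
  have "congruent2 (free_rel S) (free_rel S) (\<lambda>u v. free_rel S `` {u @ v})"
  proof (rule congruent2I[OF equiv_free_rel equiv_free_rel])
    fix y z w assume a: "w \<in> words S" "(y, z) \<in> free_rel S"
    show "free_rel S `` {y @ w} = free_rel S `` {z @ w}"
      by (rule equiv_class_eq[OF equiv_free_rel])
        (use a in \<open>auto simp: free_rel_def intro: free_equiv_append_right\<close>)
    show "free_rel S `` {w @ y} = free_rel S `` {w @ z}"
      by (rule equiv_class_eq[OF equiv_free_rel])
        (use a in \<open>auto simp: free_rel_def intro: free_equiv_append_left\<close>)
  qed
  from UN_equiv_class2[OF equiv_free_rel equiv_free_rel this assms] show ?thesis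
    by (simp add: free_group_def)
qed

lemma free_equiv_inverse: "free_equiv (rev (map (\<lambda>(b, a). (\<not> b, a)) u) @ u) []"
proof (induction u)
  case Nil
  then show ?case by (simp add: free_equiv.refl)
next
  case (Cons l u)
  obtain b a where l: "l = (b, a)" by (cases l)
  have "free_equiv (rev (map (\<lambda>(b, a). (\<not> b, a)) u) @ [(\<not> b, a), (\<not> \<not> b, a)] @ u)
                   (rev (map (\<lambda>(b, a). (\<not> b, a)) u) @ u)"
    by (rule free_equiv.cancel)
  with Cons show ?case by (auto simp: l intro: free_equiv.trans)
qed

lemma group_free_group: "group (free_group S)"
proof (rule groupI)
  have carr: "carrier (free_group S) = words S // free_rel S"
    and one: "\<one>\<^bsub>free_group S\<^esub> = free_rel S `` {[]}"
    by (simp_all add: free_group_def)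
  have nil: "[] \<in> words S" by (simp add: words_def)
  show "\<one>\<^bsub>free_group S\<^esub> \<in> carrier (free_group S)"
    by (simp add: carr one quotientI nil)
  fix A assume "A \<in> carrier (free_group S)"
  then obtain u where u: "u \<in> words S" "A = free_rel S `` {u}"
    by (auto simp: carr elim: quotientE)
  show "\<one>\<^bsub>free_group S\<^esub> \<otimes>\<^bsub>free_group S\<^esub> A = A"
    by (simp add: u one nil free_group_mult)
  let ?v = "rev (map (\<lambda>(b, a). (\<not> b, a)) u)"
  have v: "?v \<in> words S" using u(1) by (auto simp: words_def in_lists_conv_set)
  have "free_rel S `` {?v @ u} = free_rel S `` {[]}"
    by (rule equiv_class_eq[OF equiv_free_rel])
      (use u v nil free_equiv_inverse[of u] in \<open>auto simp: free_rel_def\<close>)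
  then have "free_rel S `` {?v} \<otimes>\<^bsub>free_group S\<^esub> A = \<one>\<^bsub>free_group S\<^esub>"
    using u v by (simp add: one free_group_mult)
  then show "\<exists>B \<in> carrier (free_group S). B \<otimes>\<^bsub>free_group S\<^esub> A = \<one>\<^bsub>free_group S\<^esub>"
    using v carr quotientI by metis
  fix B assume "B \<in> carrier (free_group S)"
  then obtain v where v: "v \<in> words S" "B = free_rel S `` {v}"
    by (auto simp: carr elim: quotientE)
  show "A \<otimes>\<^bsub>free_group S\<^esub> B \<in> carrier (free_group S)"
    using u v by (simp add: carr free_group_mult quotientI)
  fix D assume "D \<in> carrier (free_group S)"
  then obtain w where w: "w \<in> words S" "D = free_rel S `` {w}"
    by (auto simp: carr elim: quotientE)
  show "A \<otimes>\<^bsub>free_group S\<^esub> B \<otimes>\<^bsub>free_group S\<^esub> D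
      = A \<otimes>\<^bsub>free_group S\<^esub> (B \<otimes>\<^bsub>free_group S\<^esub> D)"
    using u v w by (simp add: free_group_mult)
qed

end

theory Submission
  imports Defs
begin

text \<open>The free rack on \<open>S\<close> is \<open>S \<times> F(S)\<close> with \<open>(c, g) \<lhd> (d, h) = (c, g h\<^sup>-\<^sup>1 d h)\<close>, so a term over
  \<open>x, y\<^sub>1, \<dots>, y\<^sub>n\<close> has a normal form \<open>(c, g)\<close>. Invertibility under substitution forces \<open>c = x\<close>, and
  the commutation law for \<open>\<lhd>\<close> is an equation in the free group on \<open>x\<^sub>0, x\<^sub>1, y\<^sub>1, \<dots>, y\<^sub>n\<close>. Putting
  \<open>x\<^sub>0 = 1\<close> and \<open>x\<^sub>1 = x\<close> in it shows that \<open>g e\<^sup>-\<^sup>1\<close> centralises \<open>x\<close>, where \<open>e\<close> is \<open>g\<close> with \<open>x\<close>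
  erased; hence \<open>g = x\<^sup>k e\<close> with \<open>e\<close> in the free group on \<open>y\<^sub>1, \<dots>, y\<^sub>n\<close>. Conversely all \<open>(x, x\<^sup>k e)\<close>
  belong to the isotropy group, and substitution multiplies them by adding the \<open>k\<close> and multiplying
  the \<open>e\<close> in reverse order.\<close>

section \<open>Words and the free group\<close>

definition word_inv :: "(bool \<times> 'a) list \<Rightarrow> (bool \<times> 'a) list" where
  "word_inv u = rev (map (\<lambda>(b, a). (\<not> b, a)) u)"

lemma word_inv_simps [simp]:
  "word_inv [] = []"
  "word_inv ((b, a) # u) = word_inv u @ [(\<not> b, a)]"
  "word_inv (u @ v) = word_inv v @ word_inv u"
  "word_inv u \<in> words S \<longleftrightarrow> u \<in> words S"
  by (force simp: word_inv_def words_def in_lists_conv_set)+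

lemma words_simps [simp]:
  "[] \<in> words S" "l # u \<in> words S \<longleftrightarrow> snd l \<in> S \<and> u \<in> words S" "rev u \<in> words S \<longleftrightarrow> u \<in> words S"
  by (cases l; auto simp: words_def in_lists_conv_set)+

lemma free_equiv_word_inv: "free_equiv u v \<Longrightarrow> free_equiv (word_inv u) (word_inv v)"
proof (induction rule: free_equiv.induct)
  case (cancel u b a v)
  then show ?case using free_equiv.cancel[of "word_inv v" b a "word_inv u"] by simp
qed (auto intro: free_equiv.intros)

lemma free_equiv_rev: "free_equiv u v \<Longrightarrow> free_equiv (rev u) (rev v)"
proof (induction rule: free_equiv.induct)
  case (cancel u b a v)
  then show ?case using free_equiv.cancel[of "rev v" "\<not> b" a "rev u"] by simp
qed (auto intro: free_equiv.intros)

lemma free_equiv_append: "free_equiv u u' \<Longrightarrow> free_equiv v v' \<Longrightarrow> free_equiv (u @ v) (u' @ v')"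
  by (blast intro: free_equiv.trans free_equiv_append_left free_equiv_append_right)

\<comment> \<open>The free group as a type of class \<open>group_add\<close>, additive in notation
  but not abelian. As a type it can be a target of \<open>lift_word\<close> and
  \<open>interp\<close>; it uses the same relation \<open>free_equiv\<close> as the carrier-based
  \<open>free_group S\<close>.\<close>
quotient_type 'a free_grp = "(bool \<times> 'a) list" / free_equiv
  by (intro equivpI reflpI sympI transpI) (blast intro: free_equiv.intros)+

instantiation free_grp :: (type) group_add
begin
lift_definition zero_free_grp :: "'a free_grp" is "[]" .
lift_definition plus_free_grp :: "'a free_grp \<Rightarrow> 'a free_grp \<Rightarrow> 'a free_grp" is "(@)"
  by (rule free_equiv_append)
lift_definition uminus_free_grp :: "'a free_grp \<Rightarrow> 'a free_grp" is word_inv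
  by (rule free_equiv_word_inv)
definition minus_free_grp :: "'a free_grp \<Rightarrow> 'a free_grp \<Rightarrow> 'a free_grp" where
  "minus_free_grp g h = g + - h"
instance
proof
  fix g h k :: "'a free_grp"
  show "g + h + k = g + (h + k)"
    by transfer (simp add: free_equiv.refl)
  show "0 + g = g" "g + 0 = g"
    by (transfer, simp add: free_equiv.refl)+
  show "- g + g = 0"
    by transfer (simp add: word_inv_def free_equiv_inverse)
qed (simp add: minus_free_grp_def)
end

abbreviation word_class :: "(bool \<times> 'a) list \<Rightarrow> 'a free_grp" where
  "word_class \<equiv> abs_free_grp"

definition gen :: "'a \<Rightarrow> 'a free_grp" where
  "gen a = word_class [(True, a)]"

lemma word_class_append: "word_class (u @ v) = word_class u + word_class v"
  by (simp add: plus_free_grp.abs_eq)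

lemma word_class_inv: "word_class (word_inv u) = - word_class u"
  by (simp add: uminus_free_grp.abs_eq)

lemma word_class_Nil: "word_class [] = 0"
  by (simp add: zero_free_grp_def)

lemma word_class_eq_iff: "word_class u = word_class v \<longleftrightarrow> free_equiv u v"
  by (rule free_grp.abs_eq_iff)

text \<open>The homomorphism given by the universal property of the free group, evaluated on words;
  \<open>lift_word_free_equiv\<close> shows that it descends to classes.\<close>

definition lift_word :: "('a \<Rightarrow> 'g::group_add) \<Rightarrow> (bool \<times> 'a) list \<Rightarrow> 'g" where
  "lift_word f u = sum_list (map (\<lambda>(b, a). if b then f a else - f a) u)"

lemma lift_word_simps [simp]:
  "lift_word f [] = 0"
  "lift_word f ((b, a) # u) = (if b then f a else - f a) + lift_word f u"
  "lift_word f (u @ v) = lift_word f u + lift_word f v"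
  by (simp_all add: lift_word_def)

lemma lift_word_inv [simp]: "lift_word f (word_inv u) = - lift_word f u"
  by (induction u) (auto simp: minus_add)

lemma lift_word_free_equiv: "free_equiv u v \<Longrightarrow> lift_word f u = lift_word f v"
  by (induction rule: free_equiv.induct) (auto simp: add.assoc)

lemma lift_word_cong: "u \<in> words S \<Longrightarrow> (\<And>a. a \<in> S \<Longrightarrow> f a = g a) \<Longrightarrow> lift_word f u = lift_word g u"
  by (induction u) auto

lemma lift_word_gen: "lift_word gen u = word_class u"
proof (induction u)
  case (Cons l u)
  have "word_class [(False, a)] = - gen a" for a :: 'a
    using word_class_inv[of "[(True, a)]"] by (simp add: gen_def)
  moreover have "word_class (l # u) = word_class [l] + word_class u"
    using word_class_append[of "[l]" u] by simp
  ultimately show ?case using Cons by (cases l) (auto simp: gen_def)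
qed (simp add: word_class_Nil)

text \<open>Erasing a generator is the same as sending it to the unit. This is how the part
  \<open>e\<close> of an action word is obtained from an interpretation.\<close>

lemma lift_word_filter: "lift_word f (filter (\<lambda>l. snd l \<noteq> x) u) = lift_word (f(x := 0)) u"
  by (induction u) auto


section \<open>Integer multiples in a group\<close>

text \<open>At most one of the two iterates is nontrivial, because \<open>nat\<close> sends negative
  integers to 0.\<close>

definition int_mult :: "int \<Rightarrow> 'g::group_add \<Rightarrow> 'g" where
  "int_mult k g = ((+) g ^^ nat k) 0 - ((+) g ^^ nat (- k)) 0"

lemma int_mult_0 [simp]: "int_mult 0 g = 0"
  by (simp add: int_mult_def)

lemma funpow_plus_commute: "g + ((+) g ^^ n) 0 = ((+) g ^^ n) 0 + (g::'g::group_add)"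
proof (induction n)
  case (Suc n)
  then have "g + (g + ((+) g ^^ n) 0) = (g + ((+) g ^^ n) 0) + g" by (simp add: add.assoc Suc[symmetric])
  then show ?case by (simp only: funpow.simps comp_apply)
qed simp

lemma int_mult_add_one: "int_mult (k + 1) g = g + int_mult k g"
proof (cases "k \<ge> 0")
  case True
  then show ?thesis by (simp add: int_mult_def nat_add_distrib)
next
  case False
  define S where "S = ((+) g ^^ nat (- (k + 1))) 0"
  have "nat (- k) = Suc (nat (- (k + 1)))" using False by simp
  then have "((+) g ^^ nat (- k)) 0 = g + S" by (simp only: S_def funpow.simps comp_apply)
  also have "\<dots> = S + g" by (simp only: S_def funpow_plus_commute)
  finally have "int_mult k g = - g + - S"
    using False by (simp add: int_mult_def minus_add)
  moreover have "int_mult (k + 1) g = - S"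
  proof -
    have "nat (k + 1) = 0" using False by simp
    then show ?thesis by (simp only: int_mult_def S_def funpow.simps id_apply diff_0)
  qed
  ultimately show ?thesis by (simp only: add_minus_cancel)
qed

lemma int_mult_diff_one: "int_mult (k - 1) g = - g + int_mult k g"
  using int_mult_add_one[of "k - 1" g] by (simp add: add.assoc[symmetric])

lemma int_mult_add: "int_mult (k + m) g = int_mult k g + int_mult m g"
proof (induction k rule: int_induct[where k = 0])
  case (step1 i)
  have "i + 1 + m = i + m + 1" by simp
  then show ?case using int_mult_add_one[of "i + m" g] by (simp only: int_mult_add_one step1 add.assoc)
next
  case (step2 i)
  have "i - 1 + m = i + m - 1" by simp
  then show ?case using int_mult_diff_one[of "i + m" g] by (simp only: int_mult_diff_one step2 add.assoc)
qed simp

lemma int_mult_commute: "g + int_mult k g = int_mult k g + g"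
  using int_mult_add[of 1 k g] int_mult_add[of k 1 g] int_mult_add_one[of 0 g]
  by (simp add: add.commute)

lemma int_mult_commute_uminus: "- g + int_mult k g = int_mult k g + - g"
proof -
  have "- g + (g + int_mult k g) + - g = - g + (int_mult k g + g) + - g"
    by (simp only: int_mult_commute)
  then show ?thesis by (simp only: add.assoc minus_add_cancel right_minus add_0_right)
qed

text \<open>Conjugation is an endomorphism. This matters because substituting a rack element for a
  constant turns each of its letters into a conjugate.\<close>

lemma int_mult_conj: "int_mult k (- p + g + p) = - p + int_mult k g + p"
proof (induction k rule: int_induct[where k = 0])
  case (step1 i)
  then show ?case by (simp add: int_mult_add_one add.assoc)
next
  case (step2 i)
  then show ?case by (simp only: int_mult_diff_one minus_add minus_minus add.assoc add_minus_cancel)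
qed simp

lemma int_mult_int: "int_mult k (1::int) = k"
proof (induction k rule: int_induct[where k = 0])
qed (simp_all add: int_mult_add_one int_mult_diff_one)

definition power_word :: "int \<Rightarrow> 'a \<Rightarrow> (bool \<times> 'a) list" where
  "power_word k a = replicate (nat k) (True, a) @ replicate (nat (- k)) (False, a)"

lemma power_word_in_words: "a \<in> S \<Longrightarrow> power_word k a \<in> words S"
  by (auto simp: power_word_def words_def in_lists_conv_set)

lemma lift_word_power_word: "lift_word f (power_word k a) = int_mult k (f a)"
proof -
  have "lift_word f (replicate m (True, a)) = ((+) (f a) ^^ m) 0"
    and "lift_word f (replicate m (False, a)) = - ((+) (f a) ^^ m) 0" for m
    by (induction m) (auto simp: funpow_plus_commute minus_add)
  then show ?thesis by (simp add: power_word_def int_mult_def)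
qed

lemma word_class_power_word: "word_class (power_word k a) = int_mult k (gen a)"
  by (metis lift_word_gen lift_word_power_word)


section \<open>Reduced words and the centraliser of a generator\<close>

text \<open>Left multiplication by a letter on reduced words. Folding it over a word computes the
  reduced form, and invariance of \<open>red\<close> under \<open>free_equiv\<close> makes reduced
  words unique representatives.\<close>

fun push :: "bool \<times> 'a \<Rightarrow> (bool \<times> 'a) list \<Rightarrow> (bool \<times> 'a) list" where
  "push l [] = [l]"
| "push l (m # u) = (if snd l = snd m \<and> fst l \<noteq> fst m then u else l # m # u)"

definition red :: "(bool \<times> 'a) list \<Rightarrow> (bool \<times> 'a) list" where
  "red u = foldr push u []"

abbreviation reduced :: "(bool \<times> 'a) list \<Rightarrow> bool" where
  "reduced \<equiv> successively (\<lambda>l m. snd l = snd m \<longrightarrow> fst l = fst m)"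

lemma reduced_push: "reduced u \<Longrightarrow> reduced (push l u)"
  by (cases u; cases "tl u") (auto simp: successively_Cons)

lemma reduced_red: "reduced (red u)"
  by (induction u) (auto simp: red_def reduced_push)

lemma red_reduced: "reduced u \<Longrightarrow> red u = u"
proof (induction u)
  case (Cons l u)
  then show ?case by (cases u) (auto simp: red_def)
qed (simp add: red_def)

text \<open>If the inner push cancels the first letter \<open>(b, a)\<close> of \<open>u\<close>,
  reducedness prevents the rest from starting with \<open>(\<not> b, a)\<close>, so the outer push
  restores that letter.\<close>

lemma push_push_inverse: "reduced u \<Longrightarrow> push (b, a) (push (\<not> b, a) u) = u"
proof (cases u)
  case (Cons m v)
  assume "reduced u"
  then show ?thesis using Cons by (cases m; cases v) auto
qed simp

lemma red_free_equiv: "free_equiv u v \<Longrightarrow> red u = red v"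
proof (induction rule: free_equiv.induct)
  case (cancel u b a v)
  then show ?case using push_push_inverse[OF reduced_red[of v], of b a] by (simp add: red_def)
qed auto

lemma free_equiv_push: "free_equiv (l # u) (push l u)"
proof (cases u)
  case Nil
  then show ?thesis by (simp add: free_equiv.refl)
next
  case (Cons m v)
  then show ?thesis
    using free_equiv.cancel[of "[]" "fst l" "snd l" v]
    by (cases l; cases m) (auto intro: free_equiv.refl)
qed

lemma free_equiv_red: "free_equiv u (red u)"
proof (induction u)
  case (Cons l u)
  then show ?case
    using free_equiv_append_left[of u "red u" "[l]"] free_equiv_push[of l "red u"]
    by (auto simp: red_def intro: free_equiv.trans)
qed (simp add: red_def free_equiv.refl)

lemma word_class_Cons: "word_class ((b, a) # u) = (if b then gen a else - gen a) + word_class u"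
  by (metis lift_word_gen lift_word_simps(2))

text \<open>A first letter that is \<open>x\<close> or its inverse commutes with \<open>x\<close>
  and can be stripped. With any other first letter, \<open>x u\<close> is already reduced and starts
  with \<open>x\<close>, while the reduced form of \<open>u x\<close> starts with the first letter
  of \<open>u\<close>, a contradiction.\<close>

lemma reduced_commutes_gen:
  assumes "reduced u" and "word_class u + gen x = gen x + word_class u"
  shows "\<exists>k. word_class u = int_mult k (gen x)"
  using assms
proof (induction u)
  case Nil
  show ?case by (rule exI[of _ 0]) (simp add: word_class_Nil)
next
  case (Cons l u)
  obtain b a where l: "l = (b, a)" by (cases l)
  show ?case
  proof (cases "a = x")
    case True
    define g where "g = (if b then gen x else - gen x)"
    have gx: "gen x = - g + gen x + g" by (auto simp: g_def)
    have lu: "word_class (l # u) = g + word_class u"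
      by (simp add: l True g_def word_class_Cons)
    have "- g + (g + word_class u + gen x) = - g + gen x + g + word_class u"
      using Cons.prems(2) unfolding lu by (simp add: add.assoc)
    then have "word_class u + gen x = gen x + word_class u"
      using gx by (metis add.assoc minus_add_cancel)
    moreover have "reduced u" using Cons.prems(1) by (auto simp: successively_Cons)
    ultimately obtain k where k: "word_class u = int_mult k (gen x)"
      using Cons.IH by blast
    have "word_class (l # u) = int_mult (if b then k + 1 else k - 1) (gen x)"
      by (simp add: lu k g_def int_mult_add_one int_mult_diff_one)
    then show ?thesis by blast
  next
    case False
    have r: "reduced ((True, x) # l # u)"
      using Cons.prems(1) False by (simp add: l)
    have e: "free_equiv ((True, x) # l # u) (l # u @ [(True, x)])"
      using Cons.prems(2)
      by (simp add: word_class_eq_iff[symmetric] l word_class_Cons word_class_append word_class_Nil add.assoc)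
    have eq: "(True, x) # l # u = red (l # u @ [(True, x)])"
      by (rule HOL.trans[OF red_reduced[OF r, symmetric] red_free_equiv[OF e]])
    show ?thesis
    proof (cases "reduced (l # u @ [(True, x)])")
      case True
      then show ?thesis using eq red_reduced[OF True] l False by simp
    next
      case not_red: False
      \<comment> \<open>Appending \<open>x\<close> can only cancel against a final inverse of
        \<open>x\<close>. The remaining prefix \<open>v\<close> is reduced and still begins with
        \<open>l\<close>, since \<open>u\<close> is nonempty.\<close>
      have "reduced ((l # u) @ [(True, x)]) \<longleftrightarrow> last (l # u) \<noteq> (False, x)"
        using Cons.prems(1) unfolding successively_append_iff
        by (cases "last (l # u)") auto
      then have last: "last (l # u) = (False, x)" using not_red by simp
      then have "u \<noteq> []" using l False by auto
      define v where "v = butlast (l # u)"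
      have lu: "l # u = v @ [(False, x)]"
        using last append_butlast_last_id[of "l # u"] by (simp add: v_def)
      have r': "reduced v"
        using Cons.prems(1) unfolding lu successively_append_iff by simp
      have e': "free_equiv (l # u @ [(True, x)]) v"
        using free_equiv.cancel[of v False x "[]"] lu by (metis append.assoc append_Cons append_Nil append_Nil2)
      have "red (l # u @ [(True, x)]) = v"
        by (rule HOL.trans[OF red_free_equiv[OF e'] red_reduced[OF r']])
      then show ?thesis using eq l False \<open>u \<noteq> []\<close> by (simp add: v_def)
    qed
  qed
qed

lemma commutes_gen_imp_int_mult:
  assumes "g + gen x = gen x + g"
  shows "\<exists>k. g = int_mult k (gen x)"
proof -
  obtain u where "g = word_class u" by (metis Quotient_abs_rep Quotient_free_grp)
  then have "g = word_class (red u)" using free_equiv_red word_class_eq_iff by blast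
  then show ?thesis using assms reduced_commutes_gen[OF reduced_red] by simp
qed


section \<open>Interpretation of rack terms\<close>

text \<open>The free rack on \<open>'d\<close> is the target \<open>'d \<times> 'g\<close> in which \<open>'g\<close> is the free group on \<open>'d\<close> and
  \<open>\<kappa>\<close> sends each element to its generator.\<close>

primrec interp :: "('d \<Rightarrow> 'g::group_add) \<Rightarrow> ('c \<Rightarrow> 'd \<times> 'g) \<Rightarrow> ('v \<Rightarrow> 'd \<times> 'g) \<Rightarrow>
    ('c, 'v) rack_term \<Rightarrow> 'd \<times> 'g" where
  "interp \<kappa> \<phi> \<rho> (Var v) = \<rho> v"
| "interp \<kappa> \<phi> \<rho> (Const c) = \<phi> c"
| "interp \<kappa> \<phi> \<rho> (s \<lhd>\<^sub>r t) = (let (c, g) = interp \<kappa> \<phi> \<rho> s; (d, h) = interp \<kappa> \<phi> \<rho> t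
     in (c, g + (- h + \<kappa> d + h)))"
| "interp \<kappa> \<phi> \<rho> (s \<lhd>\<^sub>r\<^sup>- t) = (let (c, g) = interp \<kappa> \<phi> \<rho> s; (d, h) = interp \<kappa> \<phi> \<rho> t
     in (c, g + (- h + - \<kappa> d + h)))"

lemma interp_subst_vars:
  "interp \<kappa> \<phi> \<rho> (subst_vars \<sigma> t) = interp \<kappa> \<phi> (\<lambda>v. interp \<kappa> \<phi> \<rho> (\<sigma> v)) t"
  by (induction t) auto

lemma interp_subst_const:
  "interp \<kappa> \<phi> \<rho> (subst_const c s t) = interp \<kappa> (\<phi>(c := interp \<kappa> \<phi> \<rho> s)) \<rho> t"
  by (induction t) auto

text \<open>Soundness: the target satisfies the rack axioms for every \<open>\<kappa>\<close>. The
  valuation is generalised because the rule \<open>instantiate\<close> composes it with a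
  substitution.\<close>

lemma rack_provable_sound:
  "rack_provable C s t \<Longrightarrow> interp \<kappa> \<phi> \<rho> s = interp \<kappa> \<phi> \<rho> t"
proof (induction arbitrary: \<rho> rule: rack_provable.induct)
qed (auto simp: interp_subst_vars minus_add add.assoc diff_conv_add_uminus Let_def
    simp del: add_uminus_conv_diff split: prod.splits)

section \<open>Normal form data of a closed term\<close>

primrec head_const :: "('c, 'v) rack_term \<Rightarrow> 'c" where
  "head_const (Var v) = undefined"
| "head_const (Const c) = c"
| "head_const (s \<lhd>\<^sub>r t) = head_const s"
| "head_const (s \<lhd>\<^sub>r\<^sup>- t) = head_const s"

primrec action_word :: "('c, 'v) rack_term \<Rightarrow> (bool \<times> 'c) list" where
  "action_word (Var v) = []"
| "action_word (Const c) = []"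
| "action_word (s \<lhd>\<^sub>r t) =
     action_word s @ word_inv (action_word t) @ [(True, head_const t)] @ action_word t"
| "action_word (s \<lhd>\<^sub>r\<^sup>- t) =
     action_word s @ word_inv (action_word t) @ [(False, head_const t)] @ action_word t"

text \<open>Acting by an element \<open>(d, h)\<close> adds the conjugate
  \<open>- h + \<kappa> d + h\<close> on the right, so each letter \<open>c\<close> of the action
  word contributes the conjugate belonging to \<open>\<phi> c\<close>.\<close>

lemma interp_closed:
  assumes "term_vars t = {}"
  shows "interp \<kappa> \<phi> \<rho> t = (fst (\<phi> (head_const t)), snd (\<phi> (head_const t)) +
    lift_word (\<lambda>c. - snd (\<phi> c) + \<kappa> (fst (\<phi> c)) + snd (\<phi> c)) (action_word t))"
  using assms
  by (induction t)
    (auto simp: minus_add add.assoc diff_conv_add_uminus simp del: add_uminus_conv_diff)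

lemma closed_terms_simps [simp]:
  "Const c \<in> closed_terms C \<longleftrightarrow> c \<in> C"
  "s \<lhd>\<^sub>r t \<in> closed_terms C \<longleftrightarrow> s \<in> closed_terms C \<and> t \<in> closed_terms C"
  "s \<lhd>\<^sub>r\<^sup>- t \<in> closed_terms C \<longleftrightarrow> s \<in> closed_terms C \<and> t \<in> closed_terms C"
  by (auto simp: closed_terms_def)

lemma closed_terms_subst_const:
  assumes "t \<in> closed_terms C" "s \<in> closed_terms D" "C - {c} \<subseteq> D"
  shows "subst_const c s t \<in> closed_terms D"
  using assms(1)
proof (induction t)
  case (Const d)
  then show ?case using assms by auto
qed (use assms in \<open>auto simp: closed_terms_def\<close>)

lemma closed_head_const: "t \<in> closed_terms C \<Longrightarrow> head_const t \<in> C"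
  by (induction t) (auto simp: closed_terms_def)

lemma closed_action_word: "t \<in> closed_terms C \<Longrightarrow> action_word t \<in> words C"
  by (induction t) (auto simp: closed_head_const)


section \<open>Normal forms of rack terms\<close>

fun letter_act :: "('c, 'v) rack_term \<Rightarrow> bool \<times> 'c \<Rightarrow> ('c, 'v) rack_term" where
  "letter_act t (b, c) = (if b then t \<lhd>\<^sub>r Const c else t \<lhd>\<^sub>r\<^sup>- Const c)"

definition act :: "('c, 'v) rack_term \<Rightarrow> (bool \<times> 'c) list \<Rightarrow> ('c, 'v) rack_term" where
  "act = foldl letter_act"

lemma act_simps [simp]:
  "act t [] = t"
  "act t (l # u) = act (letter_act t l) u"
  "act t (u @ v) = act (act t u) v"
  by (simp_all add: act_def)

lemma head_const_act: "head_const (act t u) = head_const t"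
proof (induction u arbitrary: t)
  case (Cons l u)
  then show ?case by (cases l) auto
qed simp

lemma action_word_act: "action_word (act t u) = action_word t @ u"
proof (induction u arbitrary: t)
  case (Cons l u)
  then show ?case by (cases l) auto
qed simp

lemma closed_act: "t \<in> closed_terms C \<Longrightarrow> u \<in> words C \<Longrightarrow> act t u \<in> closed_terms C"
proof (induction u arbitrary: t)
  case (Cons l u)
  then show ?case by (cases l) auto
qed simp

lemma closed_rack_provable_refl: "t \<in> closed_terms C \<Longrightarrow> rack_provable C t t"
  by (auto simp: closed_terms_def intro: rack_provable.refl)

lemma rack_provable_instances:
  assumes "a \<in> closed_terms C" "b \<in> closed_terms C" "c \<in> closed_terms C"
  shows "rack_provable C ((a \<lhd>\<^sub>r b) \<lhd>\<^sub>r c) ((a \<lhd>\<^sub>r c) \<lhd>\<^sub>r (b \<lhd>\<^sub>r c))"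
    and "rack_provable C ((a \<lhd>\<^sub>r b) \<lhd>\<^sub>r\<^sup>- b) a"
    and "rack_provable C ((a \<lhd>\<^sub>r\<^sup>- b) \<lhd>\<^sub>r b) a"
proof -
  define \<sigma> where "\<sigma> v = (if v = 0 then a else if v = 1 then b else c)" for v :: nat
  have \<sigma>: "term_consts (\<sigma> v) \<subseteq> C" for v
    using assms by (auto simp: \<sigma>_def closed_terms_def)
  show "rack_provable C ((a \<lhd>\<^sub>r b) \<lhd>\<^sub>r c) ((a \<lhd>\<^sub>r c) \<lhd>\<^sub>r (b \<lhd>\<^sub>r c))"
    using rack_provable.instantiate[where \<sigma> = \<sigma>, OF rack_provable.distrib \<sigma>] by (simp add: \<sigma>_def)
  show "rack_provable C ((a \<lhd>\<^sub>r b) \<lhd>\<^sub>r\<^sup>- b) a"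
    using rack_provable.instantiate[where \<sigma> = \<sigma>, OF rack_provable.cancel \<sigma>] by (simp add: \<sigma>_def)
  show "rack_provable C ((a \<lhd>\<^sub>r\<^sup>- b) \<lhd>\<^sub>r b) a"
    using rack_provable.instantiate[where \<sigma> = \<sigma>, OF rack_provable.cancel_inv \<sigma>] by (simp add: \<sigma>_def)
qed

section \<open>Rack laws uniform in both operations\<close>

definition op_sign :: "bool \<Rightarrow> ('c, 'v) rack_term \<Rightarrow> ('c, 'v) rack_term \<Rightarrow> ('c, 'v) rack_term" where
  "op_sign b s t = (if b then s \<lhd>\<^sub>r t else s \<lhd>\<^sub>r\<^sup>- t)"

lemma op_sign_closed [simp]:
  "op_sign b s t \<in> closed_terms C \<longleftrightarrow> s \<in> closed_terms C \<and> t \<in> closed_terms C"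
  by (auto simp: op_sign_def)

lemma op_sign_cong:
  "rack_provable C s s' \<Longrightarrow> rack_provable C t t' \<Longrightarrow> rack_provable C (op_sign b s t) (op_sign b s' t')"
  by (auto simp: op_sign_def intro: rack_provable.cong rack_provable.cong_inv)

lemma op_sign_cancel:
  assumes "s \<in> closed_terms C" "t \<in> closed_terms C"
  shows "rack_provable C (op_sign (\<not> b) (op_sign b s t) t) s"
  using rack_provable_instances[OF assms assms(2)] by (auto simp: op_sign_def)

text \<open>The cases with different signs are not axioms. They follow because right translations
  are invertible: one cancels a translation, distributes, and cancels again.\<close>

lemma op_sign_distrib:
  assumes "r \<in> closed_terms C" "s \<in> closed_terms C" "t \<in> closed_terms C"
  shows "rack_provable C (op_sign e (op_sign b r s) t) (op_sign b (op_sign e r t) (op_sign e s t))"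
proof -
  note [trans] = rack_provable.trans
  note refl = closed_rack_provable_refl
  have TT: "rack_provable C (op_sign True (op_sign True r s) t)
      (op_sign True (op_sign True r t) (op_sign True s t))"
    if "r \<in> closed_terms C" "s \<in> closed_terms C" for r s
    using rack_provable_instances(1)[OF that assms(3)] by (simp add: op_sign_def)
  have TF: "rack_provable C (op_sign True (op_sign False r s) t)
      (op_sign False (op_sign True r t) (op_sign True s t))"
    if rs: "r \<in> closed_terms C" "s \<in> closed_terms C" for r s
  proof -
    let ?m = "op_sign True (op_sign False r s) t"
    \<comment> \<open>Translating by \<open>s \<lhd>\<^sub>r t\<close> and back produces an inner
      term to which the positive law applies in reverse.\<close>
    have "rack_provable C ?m
        (op_sign False (op_sign True ?m (op_sign True s t)) (op_sign True s t))"
      using op_sign_cancel[of ?m C "op_sign True s t" True] rs assms(3)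
      by (auto intro: rack_provable.sym)
    also have "rack_provable C \<dots>
        (op_sign False (op_sign True (op_sign True (op_sign False r s) s) t) (op_sign True s t))"
      by (intro op_sign_cong rack_provable.sym[OF TT] refl) (use rs assms(3) in auto)
    also have "rack_provable C \<dots> (op_sign False (op_sign True r t) (op_sign True s t))"
      by (intro op_sign_cong refl) (use op_sign_cancel[OF rs, of False] rs assms(3) in auto)
    finally show ?thesis .
  qed
  have pos: "rack_provable C (op_sign True (op_sign b r s) t)
      (op_sign b (op_sign True r t) (op_sign True s t))"
    if "r \<in> closed_terms C" "s \<in> closed_terms C" for r s
    using TT TF that by (cases b) auto
  have "rack_provable C (op_sign False (op_sign b r s) t)
      (op_sign b (op_sign False r t) (op_sign False s t))"
  proof -
    let ?n = "op_sign b (op_sign False r t) (op_sign False s t)"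
    have undo: "rack_provable C (op_sign True (op_sign False q t) t) q" if "q \<in> closed_terms C" for q
      using op_sign_cancel[OF that assms(3), of False] by simp
    \<comment> \<open>Undoing \<open>t\<close> on both arguments exhibits the left side as
      \<open>?n\<close> translated by \<open>t\<close>; translating back then yields
      \<open>?n\<close>.\<close>
    have "rack_provable C (op_sign b r s)
        (op_sign b (op_sign True (op_sign False r t) t) (op_sign True (op_sign False s t) t))"
      by (intro op_sign_cong rack_provable.sym[OF undo] assms)
    also have "rack_provable C \<dots> (op_sign True ?n t)"
      by (intro rack_provable.sym[OF pos]) (use assms in auto)
    finally have "rack_provable C (op_sign False (op_sign b r s) t) (op_sign False (op_sign True ?n t) t)"
      by (intro op_sign_cong refl assms)
    also have "rack_provable C \<dots> ?n"
      using op_sign_cancel[of ?n C t True] assms by simp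
    finally show ?thesis .
  qed
  then show ?thesis using pos assms by (cases e) auto
qed

lemma letter_act_op_sign: "letter_act t (b, c) = op_sign b t (Const c)"
  by (simp add: op_sign_def)

lemma act_cong: "rack_provable C s t \<Longrightarrow> u \<in> words C \<Longrightarrow> rack_provable C (act s u) (act t u)"
proof (induction u arbitrary: s t)
  case (Cons l u)
  obtain b c where l: "l = (b, c)" by (cases l)
  have "rack_provable C (letter_act s l) (letter_act t l)"
    unfolding l letter_act_op_sign
    by (intro op_sign_cong closed_rack_provable_refl) (use Cons.prems l in auto)
  then show ?case using Cons by simp
qed simp

lemma act_red:
  "t \<in> closed_terms C \<Longrightarrow> u \<in> words C \<Longrightarrow> rack_provable C (act t u) (act t (red u))"
proof (induction u arbitrary: t)
  case Nil
  then show ?case by (simp add: red_def closed_rack_provable_refl)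
next
  case (Cons l u)
  obtain b c where l: "l = (b, c)" by (cases l)
  have lc: "letter_act t l \<in> closed_terms C" and c: "c \<in> C"
    using Cons.prems by (auto simp: l)
  have IH: "rack_provable C (act t (l # u)) (act (letter_act t l) (red u))"
    using Cons lc by simp
  show ?case
  proof (cases "push l (red u) = l # red u")
    case True
    then show ?thesis using IH by (simp add: red_def)
  next
    case False
    then obtain v where v: "red u = (\<not> b, c) # v" "push l (red u) = v"
      using l by (cases "red u") (auto split: if_splits)
    have red_words: "w \<in> words C \<Longrightarrow> red w \<in> words C" for w
    proof (induction w)
      case (Cons m w)
      then show ?case by (cases "red w") (auto simp: red_def)
    qed (simp add: red_def)
    have "v \<in> words C" using red_words[of u] Cons.prems v by simp
    moreover have "rack_provable C (letter_act (letter_act t l) (\<not> b, c)) t"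
      unfolding l letter_act_op_sign by (rule op_sign_cancel) (use Cons.prems c in auto)
    ultimately have "rack_provable C (act (letter_act t l) (red u)) (act t v)"
      using v(1) act_cong by force
    then show ?thesis using IH v(2) by (auto simp: red_def intro: rack_provable.trans)
  qed
qed

lemma act_free_equiv:
  assumes "t \<in> closed_terms C" "u \<in> words C" "v \<in> words C" "free_equiv u v"
  shows "rack_provable C (act t u) (act t v)"
  using act_red[OF assms(1,2)] act_red[OF assms(1,3)] red_free_equiv[OF assms(4)]
  by (metis rack_provable.sym rack_provable.trans)

text \<open>The element reached from \<open>d\<close> along \<open>v\<close> acts as the conjugate
  of \<open>d\<close> by \<open>v\<close>. The induction removes the last letter of
  \<open>v\<close>, the outermost operation of the term: \<open>s\<close> is rewritten as
  \<open>?s\<close> translated by that letter, which is then pulled out by distributivity.\<close>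

lemma op_sign_act:
  assumes "s \<in> closed_terms C" "d \<in> C" "v \<in> words C"
  shows "rack_provable C (op_sign b s (act (Const d) v)) (act s (word_inv v @ [(b, d)] @ v))"
  using assms(3,1)
proof (induction v arbitrary: s rule: rev_induct)
  case Nil
  then show ?case using assms(2) by (simp add: op_sign_def closed_rack_provable_refl)
next
  case (snoc l v)
  note [trans] = rack_provable.trans
  obtain e c where l: "l = (e, c)" by (cases l)
  have c: "Const c \<in> closed_terms C" and v: "v \<in> words C" using snoc.prems by (auto simp: l)
  let ?t = "act (Const d) v" and ?s = "op_sign (\<not> e) s (Const c)"
  have t: "?t \<in> closed_terms C" using assms(2) v by (simp add: closed_act)
  have s: "?s \<in> closed_terms C" using snoc.prems c by simp
  have "rack_provable C (op_sign e ?s (Const c)) s"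
    using op_sign_cancel[OF snoc.prems(2) c, of "\<not> e"] by simp
  then have "rack_provable C (op_sign b s (op_sign e ?t (Const c)))
      (op_sign b (op_sign e ?s (Const c)) (op_sign e ?t (Const c)))"
    by (intro op_sign_cong closed_rack_provable_refl) (use t c in \<open>auto intro: rack_provable.sym\<close>)
  also have "rack_provable C \<dots> (op_sign e (op_sign b ?s ?t) (Const c))"
    by (rule rack_provable.sym[OF op_sign_distrib[OF s t c]])
  also have "rack_provable C \<dots> (op_sign e (act ?s (word_inv v @ [(b, d)] @ v)) (Const c))"
    by (intro op_sign_cong snoc.IH closed_rack_provable_refl v s c)
  finally show ?case by (simp add: l letter_act_op_sign del: letter_act.simps)
qed

lemma rack_provable_normal_form:
  "t \<in> closed_terms C \<Longrightarrow> rack_provable C t (act (Const (head_const t)) (action_word t))"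
proof (induction t)
  case (Op s t)
  have st: "s \<in> closed_terms C" "t \<in> closed_terms C" using Op.prems by auto
  have nf: "act (Const (head_const s)) (action_word s) \<in> closed_terms C"
    using closed_head_const[OF st(1)] closed_action_word[OF st(1)] by (simp add: closed_act)
  have "rack_provable C (op_sign True s t)
      (op_sign True (act (Const (head_const s)) (action_word s)) (act (Const (head_const t)) (action_word t)))"
    by (intro op_sign_cong Op.IH st)
  also have "rack_provable C \<dots> (act (Const (head_const (s \<lhd>\<^sub>r t))) (action_word (s \<lhd>\<^sub>r t)))"
    using op_sign_act[of "act (Const (head_const s)) (action_word s)" C "head_const t" "action_word t" True]
      nf closed_head_const[OF st(2)] closed_action_word[OF st(2)] by simp
  finally (rack_provable.trans) show ?case by (simp add: op_sign_def)
next
  case (Op_inv s t)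
  have st: "s \<in> closed_terms C" "t \<in> closed_terms C" using Op_inv.prems by auto
  have nf: "act (Const (head_const s)) (action_word s) \<in> closed_terms C"
    using closed_head_const[OF st(1)] closed_action_word[OF st(1)] by (simp add: closed_act)
  have "rack_provable C (op_sign False s t)
      (op_sign False (act (Const (head_const s)) (action_word s)) (act (Const (head_const t)) (action_word t)))"
    by (intro op_sign_cong Op_inv.IH st)
  also have "rack_provable C \<dots> (act (Const (head_const (s \<lhd>\<^sub>r\<^sup>- t))) (action_word (s \<lhd>\<^sub>r\<^sup>- t)))"
    using op_sign_act[of "act (Const (head_const s)) (action_word s)" C "head_const t" "action_word t" False]
      nf closed_head_const[OF st(2)] closed_action_word[OF st(2)] by simp
  finally (rack_provable.trans) show ?case by (simp add: op_sign_def)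
qed (auto simp: closed_rack_provable_refl, simp add: closed_terms_def)

definition free_rack_interp :: "('c, 'v) rack_term \<Rightarrow> 'c \<times> 'c free_grp" where
  "free_rack_interp = interp gen (\<lambda>c. (c, 0)) (\<lambda>_. undefined)"

lemma free_rack_interp_closed:
  "t \<in> closed_terms C \<Longrightarrow> free_rack_interp t = (head_const t, word_class (action_word t))"
  by (simp add: free_rack_interp_def interp_closed closed_terms_def lift_word_gen)

text \<open>Soundness and completeness: terms with equal values have equal heads and freely
  equivalent action words, hence provably equal normal forms. Provability thereby becomes
  computation in a free group.\<close>

lemma rack_eq_iff:
  "(s, t) \<in> rack_eq C \<longleftrightarrow>
    s \<in> closed_terms C \<and> t \<in> closed_terms C \<and> free_rack_interp s = free_rack_interp t"
proof -
  have "rack_provable C s t"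
    if s: "s \<in> closed_terms C" and t: "t \<in> closed_terms C"
      and eq: "free_rack_interp s = free_rack_interp t"
  proof -
    have "rack_provable C (act (Const (head_const s)) (action_word s))
        (act (Const (head_const t)) (action_word t))"
      using act_free_equiv[of "Const (head_const s)" C "action_word s" "action_word t"] eq
        closed_head_const closed_action_word s t
      by (auto simp: free_rack_interp_closed[OF s] free_rack_interp_closed[OF t] word_class_eq_iff)
    then show ?thesis
      using rack_provable_normal_form[OF s] rack_provable_normal_form[OF t]
      by (meson rack_provable.sym rack_provable.trans)
  qed
  then show ?thesis
    by (auto simp: rack_eq_def free_rack_interp_def dest: rack_provable_sound)
qed

lemma rack_eq_interp:
  "(s, t) \<in> rack_eq C \<Longrightarrow> interp \<kappa> \<phi> \<rho> s = interp \<kappa> \<phi> \<rho> t"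
  by (auto simp: rack_eq_def intro: rack_provable_sound)

lemma equiv_rack_eq: "equiv (closed_terms C) (rack_eq C)"
  by (rule equivI) (auto simp: rack_eq_iff refl_on_def sym_def trans_def)


section \<open>The isotropy group\<close>

lemma gens_distinct [simp]: "Sx \<notin> gens n" "Sx0 \<notin> gens n" "Sx1 \<notin> gens n"
  by (auto simp: gens_def)

text \<open>Reversal turns the contravariant multiplication by substitution into concatenation of words.\<close>

definition iso_term :: "int \<Rightarrow> (bool \<times> const_sym) list \<Rightarrow> (const_sym, nat) rack_term" where
  "iso_term k w = act (Const Sx) (power_word k Sx @ rev w)"

abbreviation iso_class :: "nat \<Rightarrow> (const_sym, nat) rack_term \<Rightarrow> (const_sym, nat) rack_term set" where
  "iso_class n t \<equiv> rack_eq (insert Sx (gens n)) `` {t}"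

lemma words_mono: "w \<in> words S \<Longrightarrow> S \<subseteq> T \<Longrightarrow> w \<in> words T"
  by (auto simp: words_def in_lists_conv_set)

lemma iso_term_closed:
  assumes "w \<in> words (gens n)"
  shows "iso_term k w \<in> closed_terms (insert Sx (gens n))"
  unfolding iso_term_def
  by (intro closed_act) (use words_mono[OF assms, of "insert Sx (gens n)"] in
    \<open>auto simp: power_word_in_words\<close>)

text \<open>With \<open>q\<close> in place of \<open>x\<close>, the power of \<open>x\<close>
  becomes a power conjugated by \<open>snd q\<close>, and the head contributes a
  \<open>snd q\<close> in front that cancels the left half of the conjugation.\<close>

lemma interp_iso_term:
  assumes w: "w \<in> words (gens n)"
  shows "interp gen ((\<lambda>c. (c, 0))(Sx := q)) \<rho> (iso_term k w) =
    (fst q, int_mult k (gen (fst q)) + snd q + word_class (rev w))"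
proof -
  let ?f = "\<lambda>c. - snd (((\<lambda>c. (c, 0))(Sx := q)) c) + gen (fst (((\<lambda>c. (c, 0))(Sx := q)) c))
    + snd (((\<lambda>c. (c, 0))(Sx := q)) c)"
  have "lift_word ?f (rev w) = lift_word gen (rev w)"
    by (rule lift_word_cong[where S = "gens n"]) (use w in auto)
  moreover have "term_vars (iso_term k w) = {}"
    using iso_term_closed[OF w] by (simp add: closed_terms_def)
  ultimately show ?thesis
    by (simp add: interp_closed iso_term_def head_const_act action_word_act lift_word_power_word
        int_mult_conj lift_word_gen add.assoc del: fun_upd_apply)
      (simp add: int_mult_conj add.assoc[symmetric])
qed

lemma interp_subst_Sx:
  "free_rack_interp (subst_const Sx s t) =
    interp gen ((\<lambda>c. (c, 0))(Sx := free_rack_interp s)) (\<lambda>_. undefined) t"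
  by (simp add: free_rack_interp_def interp_subst_const)

lemma free_rack_interp_simps [simp]:
  "free_rack_interp (Const c) = (c, 0)"
  "free_rack_interp (s \<lhd>\<^sub>r t) = (fst (free_rack_interp s), snd (free_rack_interp s) +
     (- snd (free_rack_interp t) + gen (fst (free_rack_interp t)) + snd (free_rack_interp t)))"
  "free_rack_interp (s \<lhd>\<^sub>r\<^sup>- t) = (fst (free_rack_interp s), snd (free_rack_interp s) +
     (- snd (free_rack_interp t) + - gen (fst (free_rack_interp t)) + snd (free_rack_interp t)))"
  by (simp_all add: free_rack_interp_def split: prod.splits)

lemma free_rack_interp_iso_term:
  "w \<in> words (gens n) \<Longrightarrow>
    free_rack_interp (iso_term k w) = (Sx, int_mult k (gen Sx) + word_class (rev w))"
  using interp_iso_term[of w n "(Sx, 0)" "\<lambda>_. undefined" k]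
  by (simp add: free_rack_interp_def fun_upd_idem)

text \<open>The outer power lands before the inner value and the outer word after it, so the powers
  meet and add while the reversed words combine to \<open>rev (w @ w')\<close>.\<close>

lemma subst_iso_term_interp:
  assumes "w \<in> words (gens n)" "w' \<in> words (gens n)"
  shows "free_rack_interp (subst_const Sx (iso_term m w') (iso_term k w)) =
    free_rack_interp (iso_term (k + m) (w @ w'))"
  by (simp add: interp_subst_Sx interp_iso_term[OF assms(1)] free_rack_interp_iso_term[where n = n]
      assms int_mult_add word_class_append add.assoc)

lemma subst_closed:
  assumes "t \<in> closed_terms (insert Sx (gens n))" "s \<in> closed_terms D" "gens n \<subseteq> D"
  shows "subst_const Sx s t \<in> closed_terms D"
  using assms by (intro closed_terms_subst_const[OF assms(1)]) auto

lemma iso_term_invertible: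
  assumes w: "w \<in> words (gens n)"
  shows "isotropy_invertible n (iso_term k w)"
proof -
  let ?s = "iso_term (- k) (word_inv w)"
  have w': "word_inv w \<in> words (gens n)" using w by simp
  have "free_equiv (rev (word_inv w) @ rev w) []" "free_equiv (rev w @ rev (word_inv w)) []"
    using free_equiv_rev[of "w @ word_inv w" "[]"] free_equiv_rev[of "word_inv w @ w" "[]"]
    by (simp_all add: word_class_eq_iff[symmetric] word_class_append word_class_inv word_class_Nil)
  then have "word_class (rev (word_inv w)) + word_class (rev w) = 0"
    "word_class (rev w) + word_class (rev (word_inv w)) = 0"
    by (simp_all add: word_class_eq_iff[symmetric] word_class_append word_class_Nil)
  then have "free_rack_interp (subst_const Sx ?s (iso_term k w)) = (Sx, 0)"
    "free_rack_interp (subst_const Sx (iso_term k w) ?s) = (Sx, 0)"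
    using w w' by (simp_all add: subst_iso_term_interp[where n = n]
        free_rack_interp_iso_term[where n = n] word_class_append)
  then show ?thesis
    unfolding isotropy_invertible_def rack_eq_iff
    using iso_term_closed[OF w] iso_term_closed[OF w'] subst_closed
    by (intro bexI[of _ ?s]) (auto intro!: subst_closed)
qed

lemma iso_term_commutes:
  assumes w: "w \<in> words (gens n)"
  shows "commutes_generically n (iso_term k w)"
proof -
  \<comment> \<open>Here \<open>g\<close> is the generator of \<open>Sx1\<close> and
    \<open>h\<close> the class of \<open>rev w\<close>: conjugating a generator by its own power has
    no effect.\<close>
  have "- int_mult k g + (g + (int_mult k g + h)) = g + h"
    "- int_mult k g + (- g + (int_mult k g + h)) = - g + h" for g h :: "const_sym free_grp"
  proof -
    show "- int_mult k g + (g + (int_mult k g + h)) = g + h"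
      by (simp only: add.assoc[symmetric, of g] int_mult_commute) (simp only: add.assoc minus_add_cancel)
    show "- int_mult k g + (- g + (int_mult k g + h)) = - g + h"
      by (simp only: add.assoc[symmetric, of "- g"] int_mult_commute_uminus)
        (simp only: add.assoc minus_add_cancel)
  qed
  then show ?thesis
    unfolding commutes_generically_def rack_eq_iff
    by (auto simp: interp_subst_Sx interp_iso_term[OF w] minus_add add.assoc diff_conv_add_uminus
        intro!: subst_closed[OF iso_term_closed[OF w]] simp del: add_uminus_conv_diff)
qed

lemma isotropy_normal_form:
  assumes t: "t \<in> closed_terms (insert Sx (gens n))"
    and inv: "isotropy_invertible n t" and comm: "commutes_generically n t"
  obtains k w where "w \<in> words (gens n)" "(iso_term k w, t) \<in> rack_eq (insert Sx (gens n))"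
proof -
  have vars: "term_vars t = {}" using t by (simp add: closed_terms_def)
  define u where "u = action_word t"
  have u: "u \<in> words (insert Sx (gens n))" using closed_action_word[OF t] by (simp add: u_def)
  \<comment> \<open>Substituting for \<open>x\<close> leaves any other head unchanged, and then the
    result cannot equal \<open>x\<close>.\<close>
  have head: "head_const t = Sx"
  proof (rule ccontr)
    assume "head_const t \<noteq> Sx"
    moreover obtain s where "(subst_const Sx s t, Const Sx) \<in> rack_eq (insert Sx (gens n))"
      using inv unfolding isotropy_invertible_def by blast
    ultimately show False
      unfolding rack_eq_iff interp_subst_Sx by (simp add: interp_closed[OF vars])
  qed
  \<comment> \<open>Since soundness holds for every \<open>\<kappa>\<close>, the specialisation of
    \<open>Sx0\<close> and \<open>Sx1\<close> can be built into the target. The values at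
    \<open>Sx\<close> and at the \<open>y\<close> generators stay free.\<close>
  define \<kappa> where "\<kappa> = gen(Sx0 := 0, Sx1 := gen Sx)"
  define e where "e = lift_word (\<kappa>(Sx := 0)) u"
  define g where "g = word_class u"
  have \<kappa>_simps: "\<kappa> Sx = gen Sx" "\<kappa> Sx0 = 0" "\<kappa> Sx1 = gen Sx" by (simp_all add: \<kappa>_def)
  have lift_g: "lift_word \<kappa> u = g"
    unfolding g_def lift_word_gen[symmetric]
    by (rule lift_word_cong[OF u]) (auto simp: \<kappa>_def)
  have lift_e: "e = word_class (filter (\<lambda>l. snd l \<noteq> Sx) u)"
    unfolding e_def lift_word_gen[symmetric] lift_word_filter
    by (rule lift_word_cong[OF u]) (auto simp: \<kappa>_def)
  let ?I = "interp \<kappa> (\<lambda>c. (c, 0)) (\<lambda>_. undefined)"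
  have I: "?I (subst_const Sx s t) = (fst (?I s), snd (?I s) +
      lift_word (\<kappa>(Sx := - snd (?I s) + \<kappa> (fst (?I s)) + snd (?I s))) u)" for s
  proof -
    have "(\<lambda>c. - snd (((\<lambda>c. (c, 0))(Sx := ?I s)) c) + \<kappa> (fst (((\<lambda>c. (c, 0))(Sx := ?I s)) c))
        + snd (((\<lambda>c. (c, 0))(Sx := ?I s)) c)) = \<kappa>(Sx := - snd (?I s) + \<kappa> (fst (?I s)) + snd (?I s))"
      by auto
    then show ?thesis
      by (simp only: interp_subst_const interp_closed[OF vars] head u_def fun_upd_same)
  qed
  \<comment> \<open>Sending \<open>x\<^sub>0\<close> to the unit and \<open>x\<^sub>1\<close> to \<open>x\<close> reduces the first generic commutation law to this
    equation, which says that \<open>g - e\<close> centralises \<open>x\<close>.\<close>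
  have "gen Sx + e = e + (- g + gen Sx + g)"
  proof -
    \<comment> \<open>A substituted element with head \<open>Sx0\<close> acts trivially, so the
      action word gives \<open>e\<close> on the left side and in the first factor on the right;
      substituting \<open>Sx1\<close> gives \<open>g\<close>.\<close>
    have "?I (subst_const Sx (Const Sx0 \<lhd>\<^sub>r Const Sx1) t) =
        ?I (subst_const Sx (Const Sx0) t \<lhd>\<^sub>r subst_const Sx (Const Sx1) t)"
      using comm unfolding commutes_generically_def by (blast intro: rack_eq_interp)
    moreover have "\<kappa>(Sx := gen Sx) = \<kappa>" by (simp add: \<kappa>_def fun_upd_idem)
    ultimately show ?thesis by (simp add: I \<kappa>_simps lift_g e_def)
  qed
  then have "(g + - e) + (gen Sx + e) + - e = (g + - e) + (e + (- g + gen Sx + g)) + - e"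
    by (simp only:)
  then have "(g + - e) + gen Sx = gen Sx + (g + - e)"
    by (simp add: add.assoc diff_conv_add_uminus del: add_uminus_conv_diff)
  from commutes_gen_imp_int_mult[OF this] obtain k where "g + - e = int_mult k (gen Sx)" ..
  then have "int_mult k (gen Sx) + e = (g + - e) + e" by simp
  also have "\<dots> = g" by (simp only: add.assoc left_minus add_0_right)
  finally have "g = int_mult k (gen Sx) + e" ..
  \<comment> \<open>The reversal compensates for the one inside \<open>iso_term\<close>.\<close>
  moreover define w where "w = rev (filter (\<lambda>l. snd l \<noteq> Sx) u)"
  moreover have w: "w \<in> words (gens n)"
    using u by (auto simp: w_def words_def in_lists_conv_set)
  ultimately have "free_rack_interp (iso_term k w) = free_rack_interp t"
    unfolding free_rack_interp_iso_term[OF w]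
    by (simp add: free_rack_interp_closed[OF t] head lift_e g_def u_def)
  then show ?thesis
    using that[OF w] iso_term_closed[OF w] t by (simp add: rack_eq_iff)
qed

lemma carrier_isotropy:
  "carrier (isotropy_free_rack n) = {iso_class n (iso_term k w) | k w. w \<in> words (gens n)}"
proof -
  have "iso_class n t \<in> {iso_class n (iso_term k w) | k w. w \<in> words (gens n)}"
    if t: "t \<in> closed_terms (insert Sx (gens n))"
      and inv: "isotropy_invertible n t" and comm: "commutes_generically n t" for t
  proof -
    obtain k w where "w \<in> words (gens n)" "(iso_term k w, t) \<in> rack_eq (insert Sx (gens n))"
      using isotropy_normal_form[OF t inv comm] .
    then have "iso_class n t = iso_class n (iso_term k w)"
      using equiv_class_eq[OF equiv_rack_eq] by metis
    with \<open>w \<in> _\<close> show ?thesis by (intro CollectI exI conjI)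
  qed
  moreover have "iso_class n (iso_term k w) \<in> carrier (isotropy_free_rack n)"
    if "w \<in> words (gens n)" for k w
    unfolding isotropy_free_rack_def partial_object.simps
    using iso_term_closed[OF that] iso_term_invertible[OF that] iso_term_commutes[OF that]
    by (intro CollectI exI conjI) (rule HOL.refl)
  ultimately show ?thesis
    by (intro equalityI subsetI) (auto simp only: isotropy_free_rack_def partial_object.simps mem_Collect_eq)
qed

text \<open>Substitution respects provable equality: the value of \<open>t[s/x]\<close> is
  \<open>t\<close> interpreted with \<open>x\<close> sent to the value of \<open>s\<close>.\<close>

lemma isotropy_mult:
  assumes "t \<in> closed_terms (insert Sx (gens n))" "s \<in> closed_terms (insert Sx (gens n))"
  shows "iso_class n t \<otimes>\<^bsub>isotropy_free_rack n\<^esub> iso_class n s = iso_class n (subst_const Sx s t)"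
proof -
  let ?R = "rack_eq (insert Sx (gens n))"
  have "congruent2 ?R ?R (\<lambda>t s. iso_class n (subst_const Sx s t))"
  proof (rule congruent2I[OF equiv_rack_eq equiv_rack_eq])
    fix y z w assume w: "w \<in> closed_terms (insert Sx (gens n))" and yz: "(y, z) \<in> ?R"
    show "iso_class n (subst_const Sx w y) = iso_class n (subst_const Sx w z)"
      by (rule equiv_class_eq[OF equiv_rack_eq])
        (use w yz rack_eq_interp[OF yz] in \<open>auto simp: rack_eq_iff interp_subst_Sx intro!: subst_closed\<close>)
    show "iso_class n (subst_const Sx y w) = iso_class n (subst_const Sx z w)"
      by (rule equiv_class_eq[OF equiv_rack_eq])
        (use w yz in \<open>auto simp: rack_eq_iff interp_subst_Sx intro!: subst_closed\<close>)
  qed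
  from UN_equiv_class2[OF equiv_rack_eq equiv_rack_eq this assms] show ?thesis
    by (simp add: isotropy_free_rack_def)
qed

lemma iso_class_iso_term_eq_iff:
  assumes w: "w \<in> words (gens n)" "w' \<in> words (gens n)"
  shows "iso_class n (iso_term k w) = iso_class n (iso_term m w') \<longleftrightarrow> k = m \<and> free_equiv w w'"
proof
  assume "iso_class n (iso_term k w) = iso_class n (iso_term m w')"
  then have "(iso_term k w, iso_term m w') \<in> rack_eq (insert Sx (gens n))"
    using eq_equiv_class_iff[OF equiv_rack_eq] iso_term_closed w by blast
  then have eq: "int_mult k (gen Sx) + word_class (rev w) = int_mult m (gen Sx) + word_class (rev w')"
    by (simp add: rack_eq_iff free_rack_interp_iso_term[OF w(1)] free_rack_interp_iso_term[OF w(2)])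
  then have "free_equiv (power_word k Sx @ rev w) (power_word m Sx @ rev w')"
    by (simp add: word_class_eq_iff[symmetric] word_class_append word_class_power_word)
  \<comment> \<open>The homomorphism to the integers counting the exponent of \<open>x\<close>
    recovers \<open>k\<close>, as \<open>w\<close> and \<open>w'\<close> do not involve
    \<open>x\<close>; cancelling the power then compares the words.\<close>
  note exp = lift_word_free_equiv[OF this, of "\<lambda>c. if c = Sx then 1 else 0 :: int"]
  have zero: "lift_word (\<lambda>c. if c = Sx then 1 else 0 :: int) (rev v) = 0" if "v \<in> words (gens n)" for v
  proof -
    have "lift_word (\<lambda>c. if c = Sx then 1 else 0 :: int) (rev v) = lift_word (\<lambda>_. 0) (rev v)"
      by (rule lift_word_cong[where S = "gens n"]) (use that in auto)
    also have "\<dots> = 0" by (induction v) auto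
    finally show ?thesis .
  qed
  have "k = m" using exp zero w by (simp add: lift_word_power_word int_mult_int)
  moreover from this have "free_equiv w w'"
    using eq free_equiv_rev[of "rev w" "rev w'"] by (simp add: word_class_eq_iff)
  ultimately show "k = m \<and> free_equiv w w'" ..
next
  assume "k = m \<and> free_equiv w w'"
  then show "iso_class n (iso_term k w) = iso_class n (iso_term m w')"
    using w iso_term_closed[OF w(1)] iso_term_closed[OF w(2)] free_equiv_rev
    by (intro equiv_class_eq[OF equiv_rack_eq])
      (auto simp: rack_eq_iff free_rack_interp_iso_term[where n = n] word_class_eq_iff)
qed

definition isotropy_iso :: "nat \<Rightarrow> int \<times> (bool \<times> const_sym) list set \<Rightarrow> (const_sym, nat) rack_term set" where
  "isotropy_iso n = (\<lambda>(k, A). \<Union>w\<in>A. iso_class n (iso_term k w))"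

lemma isotropy_iso_class:
  assumes "w \<in> words (gens n)"
  shows "isotropy_iso n (k, free_rel (gens n) `` {w}) = iso_class n (iso_term k w)"
proof -
  have "congruent (free_rel (gens n)) (\<lambda>w. iso_class n (iso_term k w))"
    by (rule congruentI) (auto simp: free_rel_def iso_class_iso_term_eq_iff)
  from UN_equiv_class[OF equiv_free_rel this assms] show ?thesis
    by (simp add: isotropy_iso_def)
qed

lemma isotropy_iso_in_iso:
  "isotropy_iso n \<in> iso (integer_group \<times>\<times> free_group (gens n)) (isotropy_free_rack n)"
proof -
  let ?G = "integer_group \<times>\<times> free_group (gens n)"
  have carr: "carrier ?G = {(k, free_rel (gens n) `` {w}) | k w. w \<in> words (gens n)}"
    by (auto simp: DirProd_def free_group_def quotient_def integer_group_def)
  have image: "isotropy_iso n ` carrier ?G = carrier (isotropy_free_rack n)"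
  proof (intro equalityI subsetI)
    fix A assume "A \<in> isotropy_iso n ` carrier ?G"
    then obtain k w where "w \<in> words (gens n)" "A = isotropy_iso n (k, free_rel (gens n) `` {w})"
      unfolding carr by blast
    then show "A \<in> carrier (isotropy_free_rack n)"
      unfolding carrier_isotropy using isotropy_iso_class by blast
  next
    fix A assume "A \<in> carrier (isotropy_free_rack n)"
    then obtain k w where w: "w \<in> words (gens n)" and A: "A = iso_class n (iso_term k w)"
      unfolding carrier_isotropy by blast
    show "A \<in> isotropy_iso n ` carrier ?G"
      unfolding carr A isotropy_iso_class[OF w, symmetric] using w by blast
  qed
  have "isotropy_iso n \<in> hom ?G (isotropy_free_rack n)"
  proof (rule homI)
    show "isotropy_iso n x \<in> carrier (isotropy_free_rack n)" if "x \<in> carrier ?G" for x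
      using that image by blast
  next
    fix x y assume "x \<in> carrier ?G" "y \<in> carrier ?G"
    then obtain k w m v where w: "w \<in> words (gens n)" and v: "v \<in> words (gens n)"
      and x: "x = (k, free_rel (gens n) `` {w})" and y: "y = (m, free_rel (gens n) `` {v})"
      unfolding carr by blast
    have "isotropy_iso n (x \<otimes>\<^bsub>?G\<^esub> y) = iso_class n (iso_term (k + m) (w @ v))"
      using w v by (simp add: x y free_group_mult isotropy_iso_class)
    also have "\<dots> = iso_class n (subst_const Sx (iso_term m v) (iso_term k w))"
      using iso_term_closed[of "w @ v" n] iso_term_closed[OF w] iso_term_closed[OF v] w v
      by (intro equiv_class_eq[OF equiv_rack_eq])
        (auto simp: rack_eq_iff subst_iso_term_interp[OF w v] intro!: subst_closed)
    also have "\<dots> = isotropy_iso n x \<otimes>\<^bsub>isotropy_free_rack n\<^esub> isotropy_iso n y"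
      by (simp add: x y isotropy_iso_class w v isotropy_mult iso_term_closed)
    finally show "isotropy_iso n (x \<otimes>\<^bsub>?G\<^esub> y) =
      isotropy_iso n x \<otimes>\<^bsub>isotropy_free_rack n\<^esub> isotropy_iso n y" .
  qed
  moreover have "bij_betw (isotropy_iso n) (carrier ?G) (carrier (isotropy_free_rack n))"
  proof (rule bij_betw_imageI)
    show "inj_on (isotropy_iso n) (carrier ?G)"
    proof (rule inj_onI)
      fix x y assume "x \<in> carrier ?G" "y \<in> carrier ?G" and eq: "isotropy_iso n x = isotropy_iso n y"
      then obtain k w m v where w: "w \<in> words (gens n)" and v: "v \<in> words (gens n)"
        and x: "x = (k, free_rel (gens n) `` {w})" and y: "y = (m, free_rel (gens n) `` {v})"
        unfolding carr by blast
      have "k = m \<and> free_equiv w v"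
        using eq by (simp only: x y isotropy_iso_class w v iso_class_iso_term_eq_iff)
      then show "x = y"
        using equiv_class_eq[OF equiv_free_rel, of w v "gens n"] w v by (simp add: x y free_rel_def)
    qed
  qed (rule image)
  ultimately show ?thesis by (simp add: iso_def)
qed

theorem corollary4p11:
  fixes n :: nat
  shows "group (isotropy_free_rack n) \<and>
    isotropy_free_rack n \<cong> integer_group \<times>\<times> free_group (gens n)"
proof
  let ?G = "integer_group \<times>\<times> free_group (gens n)"
  interpret G: group ?G
    by (intro DirProd_group group_integer_group group_free_group)
  \<comment> \<open>Transport along the bijection yields a group whose unit is the image of the
    unit, so that image must be identified with the class of \<open>x\<close>.\<close>
  have one: "isotropy_iso n \<one>\<^bsub>?G\<^esub> = \<one>\<^bsub>isotropy_free_rack n\<^esub>"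
    using isotropy_iso_class[of "[]" n 0]
    by (simp add: free_group_def isotropy_free_rack_def iso_term_def power_word_def)
  then show "group (isotropy_free_rack n)"
    using G.iso_imp_img_group[OF isotropy_iso_in_iso] by simp
  show "isotropy_free_rack n \<cong> ?G"
    using G.iso_set_sym[OF isotropy_iso_in_iso] by (auto simp: is_iso_def)
qed

end
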